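(* Let $r\ge 1$ be an integer and let $p_1,\dots,p_r$ be the first $r$ prime numbers, where $p_i$ is the $i$-th prime. For $i=2,\dots,r$ let $(x'_i,t'_i)$ be any integer solution of the linear equation $$p_i x_i - t_i\prod_{k=1}^{i-1}p_k = 1 .$$ For $t\in\mathbb{Z}$ and $h_i\in\{1,2,\dots,p_i-1\}$ ($2\le i\le r$) define, if $r\ge 3$, $$Z_r(t,h_i)= t\prod_{l=1}^{r}p_l+(p_r x'_r-1)(h_r-1)+\sum_{j=2}^{r-1}\Big[(p_jx'_j-1)(h_j-1)\prod_{q=j+1}^{r}p_q x'_q\Big]-1,$$ and for $r=1,2$ $$Z_1(t,h_i)=2t+1,\qquad Z_2(t,h_i)=6t+4h_2+3 .$$ Then the set of all values of $Z_r(t,h_i)$, as $t$ ranges over $\mathbb{Z}$ and each $h_i$ over $\{1,\dots,p_i-1\}$, is exactly the set of all integers that are not divisible by any of the primes $p_1,p_2,\dots,p_r$.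
   Context: The notation $Z_r(t,h_i)$ stands for a function of $t$ and of the whole tuple $(h_2,\dots,h_r)$. *)

theory Defs
  imports "HOL-Computational_Algebra.Primes" "HOL-Library.Infinite_Set" "HOL-Library.FuncSet"
begin

(* Numbering starts at 1: nth_prime 1 = 2, nth_prime 2 = 3, ...;
   nth_prime 0 is a junk value (also 2) and is never used for r >= 1. *)
definition nth_prime :: "nat \<Rightarrow> nat" where
  "nth_prime i = enumerate {p. prime p} (i - 1)"

(* x i (for i = 2..r) plays the role of the first component x'_i of the chosen solution;
   h is the tuple (h_2, ..., h_r).  The value at r = 0 is junk. *)
definition Z :: "(nat \<Rightarrow> int) \<Rightarrow> nat \<Rightarrow> int \<Rightarrow> (nat \<Rightarrow> int) \<Rightarrow> int" where
  "Z x r t h =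
    (if r = 1 then 2 * t + 1
     else if r = 2 then 6 * t + 4 * h 2 + 3
     else t * (\<Prod>l = 1..r. int (nth_prime l))
          + (int (nth_prime r) * x r - 1) * (h r - 1)
          + (\<Sum>j = 2..r - 1. (int (nth_prime j) * x j - 1) * (h j - 1)
                              * (\<Prod>q = j + 1..r. int (nth_prime q) * x q))
          - 1)"

definition h_tuples :: "nat \<Rightarrow> (nat \<Rightarrow> int) set" where
  "h_tuples r = (\<Pi>\<^sub>E i\<in>{2..r}. {1..int (nth_prime i) - 1})"

end

theory Submission
  imports Defs "HOL-Number_Theory.Cong"
begin

text \<open>
  Coprimality to \<open>p\<^sub>1, \<dots>, p\<^sub>r\<close> is a condition on the vector of residues modulo the \<open>p\<^sub>i\<close>, and \<open>Z\<close>
  is an explicit Chinese remainder formula for those residues.  The chosen solutions satisfy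
  \<open>p\<^sub>j x\<^sub>j \<equiv> 1\<close> modulo every earlier prime, while \<open>p\<^sub>j x\<^sub>j \<equiv> 0\<close> modulo \<open>p\<^sub>j\<close> itself.  Modulo \<open>p\<^sub>i\<close>, the
  summands of \<open>Z\<close> with \<open>j > i\<close> therefore vanish through the factor \<open>p\<^sub>j x\<^sub>j - 1\<close>, those with \<open>j < i\<close>
  through the factor \<open>p\<^sub>i x\<^sub>i\<close> of their product, and the one with \<open>j = i\<close> is \<open>- (h\<^sub>i - 1)\<close>
  (lemma \<open>sum_digits_cong\<close>).  With the final \<open>- 1\<close> this gives \<open>Z \<equiv> - h\<^sub>i\<close> modulo \<open>p\<^sub>i\<close> for
  \<open>i \<ge> 2\<close>, and \<open>Z \<equiv> - 1\<close> modulo \<open>p\<^sub>1 = 2\<close>.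

  So \<open>h\<^sub>i \<in> {1, \<dots>, p\<^sub>i - 1}\<close> runs through exactly the nonzero residues, which shows that every
  value is coprime to the primes.  Conversely, for \<open>n\<close> coprime to all of them the choice
  \<open>h\<^sub>i = (- n) mod p\<^sub>i\<close> makes \<open>Z\<close> at \<open>t = 0\<close> congruent to \<open>n\<close> modulo each \<open>p\<^sub>i\<close>, hence modulo their
  product, and \<open>t\<close> shifts \<open>Z\<close> by arbitrary multiples of that product.  This is the argument for
  \<open>r \<ge> 3\<close>; the closed forms for \<open>r \<le> 2\<close> follow the same pattern with explicit constants, except
  that \<open>6 * t + 4 * h\<^sub>2 + 3\<close> has residue \<open>+ h\<^sub>2\<close> modulo \<open>3\<close>.
\<close>

lemma prime_nth_prime: "prime (nth_prime i)"
  using enumerate_in_set[OF primes_infinite] by (simp add: nth_prime_def)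

lemma coprime_nth_prime:
  assumes "1 \<le> i" "1 \<le> j" "i \<noteq> j"
  shows "coprime (nth_prime i) (nth_prime j)"
proof -
  have "i - 1 \<noteq> j - 1"
    using assms by simp
  hence "nth_prime i \<noteq> nth_prime j"
    using strict_mono_enumerate[OF primes_infinite]
    by (simp add: nth_prime_def strict_mono_eq)
  thus ?thesis
    by (rule primes_coprime[OF prime_nth_prime prime_nth_prime])
qed

lemma nth_prime_1: "nth_prime (Suc 0) = 2"
  unfolding nth_prime_def
  by (auto simp: enumerate_0 intro!: Least_equality dest: prime_ge_2_nat)

lemma nth_prime_2: "nth_prime 2 = 3"
proof -
  have "enumerate {p :: nat. prime p} (Suc 0) = (LEAST p. prime p \<and> 2 < p)"
    using nth_prime_1 by (simp add: enumerate_Suc'' primes_infinite nth_prime_def)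
  also have "\<dots> = 3"
    by (rule Least_equality) auto
  finally show ?thesis
    by (simp add: nth_prime_def)
qed

text \<open>
  The mechanism of the formula: by the two ways in which a summand can vanish modulo \<open>p i\<close>, the
  residue of the whole sum depends on the single digit \<open>g i\<close>.
\<close>
lemma sum_digits_cong:
  fixes p x g :: "nat \<Rightarrow> int"
  assumes i: "i \<le> r" and inv: "\<And>j. j \<in> {i<..r} \<Longrightarrow> [p j * x j = 1] (mod p i)"
  shows "[(\<Sum>j = a..r. (p j * x j - 1) * g j * (\<Prod>q = j + 1..r. p q * x q))
          = (if a \<le> i then - g i else 0)] (mod p i)"
proof -
  have "[(\<Sum>j = a..r. (p j * x j - 1) * g j * (\<Prod>q = j + 1..r. p q * x q))
          = (\<Sum>j = a..r. if j = i then - g j else 0)] (mod p i)"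
  proof (rule cong_sum)
    fix j assume j: "j \<in> {a..r}"
    consider "j < i" | "j = i" | "i < j" by linarith
    then show "[(p j * x j - 1) * g j * (\<Prod>q = j + 1..r. p q * x q)
               = (if j = i then - g j else 0)] (mod p i)"
    proof cases
      case 1
      have "p i * x i dvd (\<Prod>q = j + 1..r. p q * x q)"
        using 1 i by (intro dvd_prodI) auto
      hence "p i dvd (\<Prod>q = j + 1..r. p q * x q)"
        by (rule dvd_mult_left)
      thus ?thesis
        using 1 by (simp add: cong_0_iff)
    next
      case 2
      have "[(\<Prod>q = i + 1..r. p q * x q) = (\<Prod>q = i + 1..r. 1)] (mod p i)"
        by (intro cong_prod inv) auto
      moreover have "[p i * x i - 1 = - 1] (mod p i)"
        by (simp add: cong_iff_dvd_diff)
      ultimately have "[(p i * x i - 1) * g i * (\<Prod>q = i + 1..r. p q * x q)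
                        = - 1 * g i * (\<Prod>q = i + 1..r. 1)] (mod p i)"
        by (intro cong_mult cong_refl)
      thus ?thesis
        using 2 by simp
    next
      case 3
      hence "p i dvd p j * x j - 1"
        using inv[of j] j by (simp add: cong_iff_dvd_diff)
      thus ?thesis
        using 3 by (simp add: cong_0_iff)
    qed
  qed
  also have "(\<Sum>j = a..r. if j = i then - g j else 0) = (if a \<le> i then - g i else 0)"
    using i by simp
  finally show ?thesis .
qed

text \<open>
  The summand for \<open>j = r\<close> has the same shape as the others, with an empty product.
\<close>
lemma Z_eq_sum_digits:
  assumes "3 \<le> r"
  shows "Z x r t h = t * (\<Prod>l = 1..r. int (nth_prime l))
           + (\<Sum>j = 2..r. (int (nth_prime j) * x j - 1) * (h j - 1)
                          * (\<Prod>q = j + 1..r. int (nth_prime q) * x q)) - 1"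
proof -
  have "{2..r} = insert r {2..r - 1}"
    using assms by auto
  thus ?thesis
    using assms by (simp add: Z_def)
qed

theorem mainTheorem3:
  fixes r :: nat and x' t' :: "nat \<Rightarrow> int"
  assumes "r \<ge> 1"
    and "\<And>i. i \<in> {2..r} \<Longrightarrow>
           int (nth_prime i) * x' i - t' i * (\<Prod>k = 1..i - 1. int (nth_prime k)) = 1"
  shows "{Z x' r t h | t h. h \<in> h_tuples r}
         = {n :: int. \<forall>i \<in> {1..r}. \<not> int (nth_prime i) dvd n}"
proof -
  consider "r = 1" | "r = 2" | "3 \<le> r"
    using assms(1) by linarith
  then show ?thesis
  proof cases
    case 1
    have "{Z x' r t h | t h. h \<in> h_tuples r} = {2 * t + 1 | t. True}"
      using 1 by (auto simp: Z_def h_tuples_def)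
    also have "\<dots> = {n :: int. \<not> 2 dvd n}"
      by (auto elim: oddE)
    finally show ?thesis
      using 1 by (simp add: nth_prime_1)
  next
    case 2
    have "{Z x' r t h | t h. h \<in> h_tuples r} = {6 * t + 4 * k + 3 | t k. k \<in> {1..2}}"
      (is "?L = ?R")
    proof
      show "?L \<subseteq> ?R"
        using 2 by (fastforce simp: Z_def h_tuples_def nth_prime_2)
      show "?R \<subseteq> ?L"
      proof clarify
        fix t k :: int assume "k \<in> {1..2}"
        hence "(\<lambda>i\<in>{2}. k) \<in> h_tuples r"
          using 2 by (auto simp: h_tuples_def nth_prime_2)
        moreover have "6 * t + 4 * k + 3 = Z x' r t (\<lambda>i\<in>{2}. k)"
          using 2 by (simp add: Z_def)
        ultimately show "\<exists>t' h. 6 * t + 4 * k + 3 = Z x' r t' h \<and> h \<in> h_tuples r"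
          by blast
      qed
    qed
    also have "?R = {n. \<not> 2 dvd n \<and> \<not> 3 dvd n}"
    proof (intro set_eqI iffI)
      fix n :: int assume "n \<in> {n. \<not> 2 dvd n \<and> \<not> 3 dvd n}"
      hence "n mod 3 \<in> {1..2} \<and> n = 6 * ((n - 4 * (n mod 3) - 3) div 6) + 4 * (n mod 3) + 3"
        by simp presburger
      thus "n \<in> ?R" by blast
    next
      fix n :: int assume "n \<in> ?R"
      thus "n \<in> {n. \<not> 2 dvd n \<and> \<not> 3 dvd n}"
        by simp presburger
    qed
    also have "\<dots> = {n. \<forall>i \<in> {1..r}. \<not> int (nth_prime i) dvd n}"
    proof -
      have "{1..r} = {Suc 0, 2}"
        using 2 by auto
      thus ?thesis
        by (simp add: nth_prime_1 nth_prime_2)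
    qed
    finally show ?thesis .
  next
    case 3
    let ?p = "\<lambda>i. int (nth_prime i)"
    have inv: "[?p j * x' j = 1] (mod ?p i)" if "1 \<le> i" "i < j" "j \<le> r" for i j
    proof -
      have "?p j * x' j - 1 = t' j * (\<Prod>k = 1..j - 1. ?p k)"
        using assms(2)[of j] that by simp
      moreover have "?p i dvd (\<Prod>k = 1..j - 1. ?p k)"
        using that by (intro dvd_prodI) auto
      ultimately show ?thesis
        by (simp add: cong_iff_dvd_diff)
    qed
    have residue: "[Z x' r t h = (if 2 \<le> i then - h i else - 1)] (mod ?p i)"
      if i: "i \<in> {1..r}" for i t h
    proof -
      have "?p i dvd (\<Prod>l = 1..r. ?p l)"
        using i by (intro dvd_prodI) auto
      hence "[t * (\<Prod>l = 1..r. ?p l) = 0] (mod ?p i)"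
        by (simp add: cong_0_iff)
      moreover have "[(\<Sum>j = 2..r. (?p j * x' j - 1) * (h j - 1) * (\<Prod>q = j + 1..r. ?p q * x' q))
            = (if 2 \<le> i then - (h i - 1) else 0)] (mod ?p i)"
        using i inv by (intro sum_digits_cong) auto
      ultimately have "[Z x' r t h = 0 + (if 2 \<le> i then - (h i - 1) else 0) - 1] (mod ?p i)"
        unfolding Z_eq_sum_digits[OF 3] by (intro cong_add cong_diff cong_refl)
      thus ?thesis
        by (simp split: if_splits)
    qed
    show ?thesis
    proof (intro set_eqI iffI)
      fix n assume "n \<in> {Z x' r t h | t h. h \<in> h_tuples r}"
      then obtain t h where n: "n = Z x' r t h" and h: "h \<in> h_tuples r"
        by blast
      have "\<not> ?p i dvd n" if i: "i \<in> {1..r}" for i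
      proof (cases "2 \<le> i")
        case True
        hence "h i \<in> {1..?p i - 1}"
          using h i by (auto simp: h_tuples_def PiE_iff)
        hence "\<not> ?p i dvd - h i"
          by (auto simp: zdvd_not_zless)
        thus ?thesis
          using cong_dvd_iff[OF residue[OF i]] True n by simp
      next
        case False
        hence "i = Suc 0"
          using i by simp
        thus ?thesis
          using cong_dvd_iff[OF residue[OF i, of t h]] n by (simp add: nth_prime_1)
      qed
      thus "n \<in> {n. \<forall>i \<in> {1..r}. \<not> ?p i dvd n}"
        by simp
    next
      fix n assume "n \<in> {n. \<forall>i \<in> {1..r}. \<not> ?p i dvd n}"
      hence n: "\<not> ?p i dvd n" if "i \<in> {1..r}" for i
        using that by blast
      define h where "h = (\<lambda>i\<in>{2..r}. (- n) mod ?p i)"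
      have "(- n) mod ?p i \<in> {1..?p i - 1}" if "i \<in> {2..r}" for i
      proof -
        have pos: "0 < ?p i"
          using prime_gt_0_nat[OF prime_nth_prime] by simp
        have "(- n) mod ?p i \<noteq> 0"
          using n[of i] that by (simp flip: dvd_eq_mod_eq_0)
        moreover have "0 \<le> (- n) mod ?p i" "(- n) mod ?p i < ?p i"
          using pos by simp_all
        ultimately show ?thesis
          by simp
      qed
      hence h: "h \<in> h_tuples r"
        by (auto simp: h_def h_tuples_def)
      have "[Z x' r 0 h = n] (mod ?p i)" if i: "i \<in> {1..r}" for i
      proof (cases "2 \<le> i")
        case True
        have "[- ((- n) mod ?p i) = n] (mod ?p i)"
          by (simp add: cong_def mod_minus_eq)
        thus ?thesis
          using cong_trans[OF residue[OF i, of 0 h]] True i by (simp add: h_def)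
      next
        case False
        hence i1: "i = Suc 0"
          using i by simp
        hence "[- 1 = n] (mod ?p i)"
          using n[OF i] by (simp add: nth_prime_1 cong_iff_dvd_diff)
        thus ?thesis
          using cong_trans[OF residue[OF i, of 0 h]] False by simp
      qed
      hence "[Z x' r 0 h = n] (mod (\<Prod>l = 1..r. ?p l))"
        by (intro cong_cong_prod_coprime) (auto intro: coprime_nth_prime)
      then obtain t where "n = Z x' r 0 h + (\<Prod>l = 1..r. ?p l) * t"
        by (auto simp: cong_iff_lin)
      hence "n = Z x' r t h"
        by (simp add: Z_eq_sum_digits[OF 3] mult.commute)
      thus "n \<in> {Z x' r t h | t h. h \<in> h_tuples r}"
        using h by blast
    qed
  qed
qed

end
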